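(* Let $\rho_\pm>0$ and $u_\pm\in\mathbb{R}$ with $u_->u_+$. Consider the Riemann problem $$\rho_t+(\rho u)_x=0,\qquad u_t+\left(\frac{u^2}{2}\right)_x=H(x-s(t))-H(s(t)-x)\,u$$ (that is, source terms $f\equiv 1$ on the right and $g(x,t,u)=-u$ on the left of the delta shock front $x=s(t)$), with initial data $(\rho,u)(x,0)=(\rho_-,u_-)$ for $x<0$ and $(\rho,u)(x,0)=(\rho_+,u_+)$ for $x>0$. Then, as long as the delta shock exists, the Riemann solution is a delta shock solution, which can be expressed as $$(\rho,u)(x,t)=\begin{cases}(\rho_-,\,u_-e^{-t}), & x<s(t),\\ (w(t),\,u_\delta(t)), & x=s(t),\\ (\rho_+,\,u_++t), & x>s(t),\end{cases}$$ with $$s(t)=\tfrac12\left(u_-(1-e^{-t})+u_+t+\tfrac12t^2\right),$$ $$w(t)=\tfrac12(\rho_-+\rho_+)\left(u_-(1-e^{-t})-u_+t-\tfrac12t^2\right),$$ $$u_\delta(t)=\tfrac12\left(u_-e^{-t}+u_++t\right).$$ Furthermore, the delta shock disappears in finite time.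
   Context: $H$ is the standard Heaviside function; $\rho>0$ is the density and $u$ the velocity. The general system is $$\rho_t+(\rho u)_x=0,\qquad u_t+\left(\tfrac{u^2}{2}\right)_x=H(x-s(t))f(x,t,u)+H(s(t)-x)g(x,t,u),$$ where the discontinuity of the source term is located at the (unknown) delta shock front $x=s(t)$, which is to be determined together with the solution. Delta shock solution. A delta shock solution of the Riemann problem on a time interval $[0,T)$, $0<T\le\infty$, consists of a front $x=s(t)$ with $s(0)=0$, a weight $w(t)$ with $w(0)=0$, a value $u_\delta(t)$ assigned to $u$ on the front, and functions $(\rho,u)$ that are smooth on each of the regions $x<s(t)$ and $x>s(t)$, such that: (1) in $x<s(t)$, $\rho_t+(\rho u)_x=0$ and $u_t+uu_x=g(x,t,u)$, with initial value $(\rho_-,u_-)$ for $x<0$; in $x>s(t)$, $\rho_t+(\rho u)_x=0$ and $u_t+uu_x=f(x,t,u)$, with initial value $(\rho_+,u_+)$ for $x>0$; (2) the generalized Rankine–Hugoniot conditions hold along $x=s(t)$: $$\frac{ds}{dt}=\sigma(t)=u_\delta(t),\qquad \frac{dw}{dt}=\sigma(t)[\rho]-[\rho u],\qquad \sigma(t)[u]=\left[\tfrac{u^2}{2}\right],$$ where $[h]=h(s(t)+0,t)-h(s(t)-0,t)$ denotes the jump across the front; (3) the $\delta$-entropy condition holds: $u(s(t)+0,t)<\dfrac{ds}{dt}<u(s(t)-0,t)$ for all $t\in[0,T)$. In the displayed form of the solution, the value $(w(t),u_\delta(t))$ on $x=s(t)$ means that $\rho$ carries a Dirac delta of weight $w(t)$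 on the front (in the sense of the conditions above) and that $u$ takes the value $u_\delta(t)$ there. The delta shock disappears in finite time if there is $T\in(0,\infty)$ such that the displayed formulas define a delta shock solution on $[0,T)$ and the $\delta$-entropy inequalities, evaluated with these formulas, fail at $t=T$; "as long as the delta shock exists" means for $0\le t<T$. *)

theory Defs
  imports "HOL-Analysis.Analysis"
begin

text \<open>Functions of space and time are curried, \<open>h x t\<close>; a point of the \<open>(x, t)\<close> plane is a pair
  with the space coordinate first.\<close>

text \<open>\<open>C\<^sup>k\<close> regularity, with derivatives taken as two-dimensional Frechet derivatives relative to \<open>S\<close>,
  which are one-sided in time at those points of \<open>S\<close> that have \<open>t = 0\<close>. For the regions used
  below (relatively open in \<open>t \<ge> 0\<close>) these derivatives are unique.\<close>

primrec Ck_on :: "nat \<Rightarrow> (real \<times> real) set \<Rightarrow> (real \<times> real \<Rightarrow> real) \<Rightarrow> bool" where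
  "Ck_on 0 S h \<longleftrightarrow> continuous_on S h"
| "Ck_on (Suc k) S h \<longleftrightarrow>
    (\<exists>hx ht. Ck_on k S hx \<and> Ck_on k S ht \<and>
      (\<forall>p\<in>S. (h has_derivative (\<lambda>q. hx p * fst q + ht p * snd q)) (at p within S)))"

definition smooth_on :: "(real \<times> real) set \<Rightarrow> (real \<Rightarrow> real \<Rightarrow> real) \<Rightarrow> bool" where
  "smooth_on S h \<longleftrightarrow> (\<forall>k. Ck_on k S (\<lambda>(x, t). h x t))"

text \<open>The time derivative is one-sided at \<open>t = 0\<close>.\<close>

definition dt :: "(real \<Rightarrow> real \<Rightarrow> real) \<Rightarrow> real \<Rightarrow> real \<Rightarrow> real" where
  "dt h x t = vector_derivative (\<lambda>\<tau>. h x \<tau>) (at t within {0..})"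

definition dx :: "(real \<Rightarrow> real \<Rightarrow> real) \<Rightarrow> real \<Rightarrow> real \<Rightarrow> real" where
  "dx h x t = deriv (\<lambda>\<xi>. h \<xi> t) x"

definition time_domain :: "ereal \<Rightarrow> real set" where
  "time_domain T = {t. 0 \<le> t \<and> ereal t < T}"

definition left_region :: "ereal \<Rightarrow> (real \<Rightarrow> real) \<Rightarrow> (real \<times> real) set" where
  "left_region T s = {(x, t). t \<in> time_domain T \<and> x < s t}"

definition right_region :: "ereal \<Rightarrow> (real \<Rightarrow> real) \<Rightarrow> (real \<times> real) set" where
  "right_region T s = {(x, t). t \<in> time_domain T \<and> s t < x}"

text \<open>Smooth solutions, with positive density, of
  \<open>\<rho>\<^sub>t + (\<rho>u)\<^sub>x = 0\<close> and \<open>u\<^sub>t + u u\<^sub>x = F(x,t,u)\<close> on a region.\<close>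

definition smooth_solution_on ::
  "(real \<times> real) set \<Rightarrow> (real \<Rightarrow> real \<Rightarrow> real \<Rightarrow> real) \<Rightarrow>
   (real \<Rightarrow> real \<Rightarrow> real) \<Rightarrow> (real \<Rightarrow> real \<Rightarrow> real) \<Rightarrow> bool" where
  "smooth_solution_on S F \<rho> u \<longleftrightarrow>
    smooth_on S \<rho> \<and> smooth_on S u \<and>
    (\<forall>(x, t)\<in>S.
      \<rho> x t > 0 \<and>
      dt \<rho> x t + dx (\<lambda>x t. \<rho> x t * u x t) x t = 0 \<and>
      dt u x t + u x t * dx u x t = F x t (u x t))"

text \<open>One-sided traces \<open>h(s(t) - 0, t)\<close> and \<open>h(s(t) + 0, t)\<close>. Their values are only
  meaningful if the limits exist, which is recorded separately in \<open>has_traces\<close>.\<close>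

definition left_trace :: "(real \<Rightarrow> real \<Rightarrow> real) \<Rightarrow> (real \<Rightarrow> real) \<Rightarrow> real \<Rightarrow> real" where
  "left_trace h s t = Lim (at_left (s t)) (\<lambda>x. h x t)"

definition right_trace :: "(real \<Rightarrow> real \<Rightarrow> real) \<Rightarrow> (real \<Rightarrow> real) \<Rightarrow> real \<Rightarrow> real" where
  "right_trace h s t = Lim (at_right (s t)) (\<lambda>x. h x t)"

definition has_traces :: "(real \<Rightarrow> real \<Rightarrow> real) \<Rightarrow> (real \<Rightarrow> real) \<Rightarrow> real \<Rightarrow> bool" where
  "has_traces h s t \<longleftrightarrow>
    (\<exists>l. ((\<lambda>x. h x t) \<longlongrightarrow> l) (at_left (s t))) \<and>
    (\<exists>l. ((\<lambda>x. h x t) \<longlongrightarrow> l) (at_right (s t)))"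

definition jump :: "(real \<Rightarrow> real \<Rightarrow> real) \<Rightarrow> (real \<Rightarrow> real) \<Rightarrow> real \<Rightarrow> real" where
  "jump h s t = right_trace h s t - left_trace h s t"

definition rankine_hugoniot ::
  "(real \<Rightarrow> real) \<Rightarrow> (real \<Rightarrow> real) \<Rightarrow> (real \<Rightarrow> real) \<Rightarrow>
   (real \<Rightarrow> real \<Rightarrow> real) \<Rightarrow> (real \<Rightarrow> real \<Rightarrow> real) \<Rightarrow> real \<Rightarrow> bool" where
  "rankine_hugoniot s w u\<delta> \<rho> u t \<longleftrightarrow>
    (s has_real_derivative u\<delta> t) (at t within {0..}) \<and>
    (w has_real_derivative u\<delta> t * jump \<rho> s t - jump (\<lambda>x t. \<rho> x t * u x t) s t) (at t within {0..}) \<and>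
    u\<delta> t * jump u s t = jump (\<lambda>x t. (u x t)\<^sup>2 / 2) s t"

definition delta_entropy :: "(real \<Rightarrow> real) \<Rightarrow> (real \<Rightarrow> real \<Rightarrow> real) \<Rightarrow> real \<Rightarrow> bool" where
  "delta_entropy s u t \<longleftrightarrow>
    right_trace u s t < vector_derivative s (at t within {0..}) \<and>
    vector_derivative s (at t within {0..}) < left_trace u s t"

text \<open>On the front itself the value of \<open>u\<close> is \<open>u\<delta> t\<close>, while the value of \<open>\<rho>\<close> is, by the usual
  notational convention, the weight \<open>w t\<close> of the Dirac delta carried by the density there. The
  remaining conditions never evaluate \<open>\<rho>\<close> or \<open>u\<close> on the front; the weight enters through the
  generalized Rankine--Hugoniot conditions.\<close>

definition delta_shock_solution ::
  "(real \<Rightarrow> real \<Rightarrow> real \<Rightarrow> real) \<Rightarrow> (real \<Rightarrow> real \<Rightarrow> real \<Rightarrow> real) \<Rightarrow>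
   real \<times> real \<Rightarrow> real \<times> real \<Rightarrow> ereal \<Rightarrow>
   (real \<Rightarrow> real) \<Rightarrow> (real \<Rightarrow> real) \<Rightarrow> (real \<Rightarrow> real) \<Rightarrow>
   (real \<Rightarrow> real \<Rightarrow> real) \<Rightarrow> (real \<Rightarrow> real \<Rightarrow> real) \<Rightarrow> bool" where
  "delta_shock_solution f g left_data right_data T s w u\<delta> \<rho> u \<longleftrightarrow>
    0 < T \<and> s 0 = 0 \<and> w 0 = 0 \<and>
    smooth_solution_on (left_region T s) g \<rho> u \<and>
    (\<forall>x<0. (\<rho> x 0, u x 0) = left_data) \<and>
    smooth_solution_on (right_region T s) f \<rho> u \<and>
    (\<forall>x>0. (\<rho> x 0, u x 0) = right_data) \<and>
    (\<forall>t\<in>time_domain T.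
      \<rho> (s t) t = w t \<and> u (s t) t = u\<delta> t \<and>
      has_traces \<rho> s t \<and> has_traces u s t \<and>
      rankine_hugoniot s w u\<delta> \<rho> u t \<and>
      delta_entropy s u t)"

end

theory Submission
  imports Defs
begin

text \<open>Both source terms are independent of position, so data that are constant on a side of the front
  stay constant in space there. The nonlinear term \<open>u u\<^sub>x\<close> then vanishes, \<open>u\<close> solves
  the ordinary differential equation \<open>u' = - u\<close> (left) or \<open>u' = 1\<close> (right), and \<open>\<rho>\<close> does not change
  because \<open>u\<^sub>x = 0\<close> (lemma \<open>uniform_state_smooth_solution\<close>).

  Write \<open>L = u\<^sub>- e\<^sup>-\<^sup>t\<close> and \<open>R = u\<^sub>+ + t\<close> for the two traces of \<open>u\<close>. Unless \<open>L = R\<close>, the condition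
  \<open>\<sigma> [u] = [u\<^sup>2/2]\<close> forces the front to move with the mean velocity \<open>\<sigma> = (L + R)/2\<close>; the mass balance then
  gives \<open>w' = (\<rho>\<^sub>- + \<rho>\<^sub>+)(L - R)/2\<close>. Integrating these from \<open>0\<close> gives the formulas for \<open>s\<close> and \<open>w\<close>.

  Since \<open>\<sigma>\<close> is the mean of \<open>L\<close> and \<open>R\<close>, both entropy inequalities amount to the single condition
  \<open>L - R > 0\<close>. The gap \<open>L - R\<close> is continuous, starts at \<open>u\<^sub>- - u\<^sub>+ > 0\<close> and tends to \<open>-\<infinity>\<close>, as the left state
  decays while the right one accelerates. The delta shock therefore lives exactly until the first
  zero of the gap (lemma \<open>continuous_first_zero\<close>). Monotonicity cannot be used
  to locate it, because for \<open>u\<^sub>- < -1\<close> the gap increases at first.\<close>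

section \<open>Smoothness of functions of time\<close>

lemma Ck_on_const: "Ck_on k S (\<lambda>_. c)"
proof (induction k arbitrary: c)
  case (Suc k)
  show ?case
    unfolding Ck_on.simps
    by (intro exI[of _ "\<lambda>_. 0"] conjI Suc ballI) simp
qed simp

text \<open>For a function of time alone the only partial derivative that can be nonzero is \<open>f'\<close>, so
  regularity can be gained one order at a time from that of \<open>f'\<close>.\<close>

lemma Ck_on_Suc_time:
  assumes "Ck_on k S (\<lambda>p. f' (snd p))"
    and f: "\<And>t. (f has_real_derivative f' t) (at t)"
  shows "Ck_on (Suc k) S (\<lambda>p. f (snd p))"
proof -
  have "((\<lambda>p. f (snd p)) has_derivative (\<lambda>q. 0 * fst q + f' (snd p) * snd q)) (at p within S)"
    for p :: "real \<times> real"
  proof -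
    have "(f has_derivative (\<lambda>y. f' (snd p) * y)) (at (snd p))"
      using f[of "snd p"] by (simp add: has_field_derivative_def)
    from has_derivative_compose[OF has_derivative_snd[OF has_derivative_ident] this]
    show ?thesis by simp
  qed
  then show ?thesis
    unfolding Ck_on.simps
    by (intro exI[of _ "\<lambda>_. 0"] exI[of _ "\<lambda>p. f' (snd p)"] conjI Ck_on_const assms(1)) auto
qed

lemma smooth_on_const: "smooth_on S (\<lambda>x t. c)"
  by (simp add: smooth_on_def split_def Ck_on_const)

lemma smooth_on_exp_decay: "smooth_on S (\<lambda>x t. c * exp (- t))"
proof -
  have "Ck_on k S (\<lambda>p. c * exp (- snd p))" for k
  proof (induction k arbitrary: c)
    case 0
    show ?case by (auto intro!: continuous_intros)
  next
    case (Suc k)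
    show ?case
      by (rule Ck_on_Suc_time[where f = "\<lambda>t. c * exp (- t)" and f' = "\<lambda>t. - c * exp (- t)"])
        (use Suc[of "- c"] in \<open>auto intro!: derivative_eq_intros\<close>)
  qed
  then show ?thesis by (simp add: smooth_on_def split_def)
qed

lemma smooth_on_shifted_time: "smooth_on S (\<lambda>x t. c + t)"
proof -
  have "Ck_on k S (\<lambda>p. c + snd p)" for k
  proof (cases k)
    case 0
    then show ?thesis by (auto intro!: continuous_intros)
  next
    case (Suc j)
    show ?thesis
      unfolding Suc
      by (rule Ck_on_Suc_time[where f = "\<lambda>t. c + t" and f' = "\<lambda>_. 1"])
        (auto intro!: derivative_eq_intros Ck_on_const)
  qed
  then show ?thesis by (simp add: smooth_on_def split_def)
qed

lemma Ck_on_cong: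
  assumes "\<And>p. p \<in> S \<Longrightarrow> h p = k p"
  shows "Ck_on n S h \<longleftrightarrow> Ck_on n S k"
proof (cases n)
  case 0
  then show ?thesis using assms by (simp cong: continuous_on_cong)
next
  case (Suc m)
  have "(h has_derivative D) (at p within S) \<longleftrightarrow> (k has_derivative D) (at p within S)"
    if "p \<in> S" for p D
    using assms that has_derivative_transform[of p S h k D]
      has_derivative_transform[of p S k h D] by metis
  then show ?thesis by (simp add: Suc cong: conj_cong)
qed

lemma smooth_on_cong:
  assumes "\<And>x t. (x, t) \<in> S \<Longrightarrow> h x t = k x t"
  shows "smooth_on S h \<longleftrightarrow> smooth_on S k"
  unfolding smooth_on_def using assms by (intro all_cong1 Ck_on_cong) auto

section \<open>Spatially uniform solutions\<close>

text \<open>The partial derivatives at a point only see the values on the segments through it; these lie in \<open>S\<close>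
  near the point when \<open>S\<close> is open relative to \<open>t \<ge> 0\<close>.\<close>

lemma eventually_in_openin_halfplane:
  assumes "openin (top_of_set (UNIV \<times> {0..})) S" and "(x, t) \<in> S"
  shows "eventually (\<lambda>\<tau>. (x, \<tau>) \<in> S) (at t within {0..})"
    and "eventually (\<lambda>\<xi>. (\<xi>, t) \<in> S) (nhds x)"
proof -
  obtain G where G: "open G" "S = (UNIV \<times> {0..}) \<inter> G"
    using assms(1) by (auto simp: openin_open)
  have t: "0 \<le> t" and xt: "(x, t) \<in> G" using assms(2) G(2) by auto
  have "open ((\<lambda>\<tau>. (x, \<tau>)) -` G)" and "open ((\<lambda>\<xi>. (\<xi>, t)) -` G)"
    by (intro open_vimage G(1) continuous_intros)+
  then have "eventually (\<lambda>\<tau>. (x, \<tau>) \<in> G) (nhds t)" and x: "eventually (\<lambda>\<xi>. (\<xi>, t) \<in> G) (nhds x)"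
    using xt by (auto simp: eventually_nhds)
  then show "eventually (\<lambda>\<tau>. (x, \<tau>) \<in> S) (at t within {0..})"
    by (auto simp: eventually_at_filter G(2) elim: eventually_mono)
  show "eventually (\<lambda>\<xi>. (\<xi>, t) \<in> S) (nhds x)"
    using x t by (auto simp: G(2) elim: eventually_mono)
qed

lemma vector_derivative_within_nonneg_times:
  fixes f :: "real \<Rightarrow> real"
  assumes "(f has_real_derivative d) (at t within {0..})" and "0 \<le> t"
  shows "vector_derivative f (at t within {0..}) = d"
proof (rule vector_derivative_within)
  show "(f has_vector_derivative d) (at t within {0..})"
    using assms(1) by (simp add: has_real_derivative_iff_has_vector_derivative)
  have "at_right t \<le> at t within {0..}"
    using assms(2) by (intro at_le) auto
  then show "at t within {0..} \<noteq> bot"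
    using trivial_limit_at_right_real[of t] by (metis bot.extremum_uniqueI)
qed

lemma dt_uniform:
  assumes "openin (top_of_set (UNIV \<times> {0..})) S" and "(x, t) \<in> S"
    and eq: "\<And>x t. (x, t) \<in> S \<Longrightarrow> h x t = U t"
    and U: "(U has_real_derivative d) (at t)"
  shows "dt h x t = d"
proof -
  have "eventually (\<lambda>\<tau>. U \<tau> = h x \<tau>) (at t within {0..})"
    using eventually_in_openin_halfplane(1)[OF assms(1,2)] by eventually_elim (simp add: eq)
  moreover have "U t = h x t" using eq assms(2) by simp
  moreover have t: "0 \<le> t"
    using openin_imp_subset[OF assms(1)] assms(2) by auto
  moreover have "(U has_real_derivative d) (at t within {0..})"
    using U by (rule DERIV_subset) simp
  ultimately have "(h x has_real_derivative d) (at t within {0..})"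
    using has_field_derivative_cong_eventually[of U "h x" t "{0..}"] by simp
  then show ?thesis
    using vector_derivative_within_nonneg_times[OF _ t] by (simp add: dt_def)
qed

lemma dx_uniform:
  assumes "openin (top_of_set (UNIV \<times> {0..})) S" and "(x, t) \<in> S"
    and eq: "\<And>x t. (x, t) \<in> S \<Longrightarrow> h x t = U t"
  shows "dx h x t = 0"
proof -
  have "eventually (\<lambda>\<xi>. h \<xi> t = U t) (nhds x)"
    using eventually_in_openin_halfplane(2)[OF assms(1,2)] by eventually_elim (simp add: eq)
  then have "deriv (\<lambda>\<xi>. h \<xi> t) x = deriv (\<lambda>_. U t) x"
    by (intro deriv_cong_ev) auto
  then show ?thesis by (simp add: dx_def)
qed

text \<open>All \<open>x\<close>-derivatives vanish, which reduces the system to \<open>\<rho>' = 0\<close> and \<open>U' = F\<close>.\<close>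

lemma uniform_state_smooth_solution:
  assumes S: "openin (top_of_set (UNIV \<times> {0..})) S"
    and \<rho>: "\<And>x t. (x, t) \<in> S \<Longrightarrow> \<rho> x t = r" and "0 < r"
    and u: "\<And>x t. (x, t) \<in> S \<Longrightarrow> u x t = U t"
    and U: "smooth_on S (\<lambda>x t. U t)"
    and ode: "\<And>x t. (x, t) \<in> S \<Longrightarrow> (U has_real_derivative F x t (U t)) (at t)"
  shows "smooth_solution_on S F \<rho> u"
proof -
  have "smooth_on S \<rho>" and "smooth_on S u"
    using smooth_on_cong[of S \<rho> "\<lambda>x t. r"] smooth_on_cong[of S u "\<lambda>x t. U t"]
      \<rho> u U smooth_on_const by auto
  moreover have "dt \<rho> x t = 0" "dx (\<lambda>x t. \<rho> x t * u x t) x t = 0"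
      "dt u x t = F x t (U t)" "dx u x t = 0" if "(x, t) \<in> S" for x t
  proof -
    show "dt \<rho> x t = 0"
      using dt_uniform[OF S that, of \<rho> "\<lambda>_. r" 0] \<rho> by simp
    show "dx (\<lambda>x t. \<rho> x t * u x t) x t = 0"
      using dx_uniform[OF S that, of "\<lambda>x t. \<rho> x t * u x t" "\<lambda>t. r * U t"] \<rho> u by simp
    show "dt u x t = F x t (U t)"
      using dt_uniform[OF S that u ode[OF that]] by simp
    show "dx u x t = 0"
      using dx_uniform[OF S that u] by simp
  qed
  ultimately show ?thesis
    using \<rho> u \<open>0 < r\<close> by (auto simp: smooth_solution_on_def)
qed

lemma openin_left_region:
  assumes "continuous_on UNIV s"
  shows "openin (top_of_set (UNIV \<times> {0..})) (left_region (ereal T) s)"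
proof -
  have "open {p::real \<times> real. fst p < s (snd p)}" "open {p::real \<times> real. snd p < T}"
    by (intro open_Collect_less continuous_intros continuous_on_compose2[OF assms]; simp)+
  then have "open ({p. fst p < s (snd p)} \<inter> {p::real \<times> real. snd p < T})" by (rule open_Int)
  moreover have "left_region (ereal T) s =
      (UNIV \<times> {0..}) \<inter> ({p. fst p < s (snd p)} \<inter> {p. snd p < T})"
    by (auto simp: left_region_def time_domain_def)
  ultimately show ?thesis by (auto simp: openin_open)
qed

lemma openin_right_region:
  assumes "continuous_on UNIV s"
  shows "openin (top_of_set (UNIV \<times> {0..})) (right_region (ereal T) s)"
proof -
  have "open {p::real \<times> real. s (snd p) < fst p}" "open {p::real \<times> real. snd p < T}"
    by (intro open_Collect_less continuous_intros continuous_on_compose2[OF assms]; simp)+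
  then have "open ({p. s (snd p) < fst p} \<inter> {p::real \<times> real. snd p < T})" by (rule open_Int)
  moreover have "right_region (ereal T) s =
      (UNIV \<times> {0..}) \<inter> ({p. s (snd p) < fst p} \<inter> {p. snd p < T})"
    by (auto simp: right_region_def time_domain_def)
  ultimately show ?thesis by (auto simp: openin_open)
qed

section \<open>Conditions on the front\<close>

lemma tendsto_one_sided_const:
  fixes a :: real and h :: "real \<Rightarrow> real"
  shows "(\<And>x. x < a \<Longrightarrow> h x = l) \<Longrightarrow> (h \<longlongrightarrow> l) (at_left a)"
    and "(\<And>x. a < x \<Longrightarrow> h x = r) \<Longrightarrow> (h \<longlongrightarrow> r) (at_right a)"
  by (auto intro!: tendsto_eventually simp: eventually_at_filter)

lemma left_trace_uniform:
  assumes "\<And>x. x < s t \<Longrightarrow> h x t = l"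
  shows "left_trace h s t = l"
  unfolding left_trace_def
  by (intro tendsto_Lim tendsto_one_sided_const assms) simp_all

lemma right_trace_uniform:
  assumes "\<And>x. s t < x \<Longrightarrow> h x t = r"
  shows "right_trace h s t = r"
  unfolding right_trace_def
  by (intro tendsto_Lim tendsto_one_sided_const assms) simp_all

lemma has_traces_uniform:
  assumes "\<And>x. x < s t \<Longrightarrow> h x t = l" and "\<And>x. s t < x \<Longrightarrow> h x t = r"
  shows "has_traces h s t"
  unfolding has_traces_def using tendsto_one_sided_const assms by metis

lemma jump_uniform:
  assumes "\<And>x. x < s t \<Longrightarrow> h x t = l" and "\<And>x. s t < x \<Longrightarrow> h x t = r"
  shows "jump h s t = r - l"
  using assms by (simp add: jump_def left_trace_uniform right_trace_uniform)

text \<open>The jump condition for \<open>u\<close> holds because \<open>(l + r)(r - l) = r\<^sup>2 - l\<^sup>2\<close>, and the rate of \<open>w\<close> is the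
  right one because \<open>(l + r)(b - a)/2 - (b r - a l) = (a + b)(l - r)/2\<close>.\<close>

lemma rankine_hugoniot_mean_velocity:
  assumes \<rho>: "\<And>x. x < s t \<Longrightarrow> \<rho> x t = a" "\<And>x. s t < x \<Longrightarrow> \<rho> x t = b"
    and u: "\<And>x. x < s t \<Longrightarrow> u x t = l" "\<And>x. s t < x \<Longrightarrow> u x t = r"
    and v: "v t = (l + r) / 2"
    and s: "(s has_real_derivative (l + r) / 2) (at t within {0..})"
    and w: "(w has_real_derivative (a + b) * (l - r) / 2) (at t within {0..})"
  shows "rankine_hugoniot s w v \<rho> u t"
proof -
  have "jump \<rho> s t = b - a" "jump u s t = r - l"
    using \<rho> u by (auto intro!: jump_uniform)
  moreover have "jump (\<lambda>x t. \<rho> x t * u x t) s t = b * r - a * l"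
    using \<rho> u by (intro jump_uniform) simp_all
  moreover have "jump (\<lambda>x t. (u x t)\<^sup>2 / 2) s t = r\<^sup>2 / 2 - l\<^sup>2 / 2"
    using u by (intro jump_uniform) simp_all
  moreover have "(a + b) * (l - r) / 2 = v t * (b - a) - (b * r - a * l)"
    and "v t * (r - l) = r\<^sup>2 / 2 - l\<^sup>2 / 2"
    unfolding v by (simp_all add: field_simps power2_eq_square)
  ultimately show ?thesis
    using s w unfolding rankine_hugoniot_def by (simp only: v simp_thms)
qed

text \<open>The mean of \<open>l\<close> and \<open>r\<close> is above \<open>r\<close> exactly when it is below \<open>l\<close>, so the two entropy
  inequalities collapse to one.\<close>

lemma delta_entropy_mean_velocity_iff:
  assumes u: "\<And>x. x < s t \<Longrightarrow> u x t = l" "\<And>x. s t < x \<Longrightarrow> u x t = r"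
    and s: "(s has_real_derivative (l + r) / 2) (at t within {0..})" and "0 \<le> t"
  shows "delta_entropy s u t \<longleftrightarrow> r < l"
proof -
  have "left_trace u s t = l" "right_trace u s t = r"
    using u by (auto intro!: left_trace_uniform right_trace_uniform)
  then show ?thesis
    using vector_derivative_within_nonneg_times[OF s \<open>0 \<le> t\<close>]
    by (auto simp: delta_entropy_def)
qed

text \<open>The zero set in \<open>[a, b]\<close> is compact and, by the intermediate value theorem, nonempty; before its
  least element a sign change would create an earlier zero.\<close>

lemma continuous_first_zero:
  fixes f :: "real \<Rightarrow> real"
  assumes f: "continuous_on {a..b} f" and "a \<le> b" "f a > 0" "f b \<le> 0"
  obtains c where "a < c" "c \<le> b" "f c = 0" "\<And>t. a \<le> t \<Longrightarrow> t < c \<Longrightarrow> f t > 0"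
proof -
  let ?Z = "{t \<in> {a..b}. f t = 0}"
  have "closed ?Z"
    using continuous_closed_preimage_constant[OF f closed_atLeastAtMost] by simp
  then have "compact ?Z"
    using bounded_subset[OF bounded_closed_interval[of a b], of ?Z]
    unfolding compact_eq_bounded_closed by blast
  moreover have "?Z \<noteq> {}"
    using IVT2'[of f b 0 a] assms by auto
  ultimately obtain c where c: "c \<in> ?Z" and least: "\<And>t. t \<in> ?Z \<Longrightarrow> c \<le> t"
    using compact_attains_inf[of ?Z] by auto
  have "f t > 0" if t: "a \<le> t" "t < c" for t
  proof (rule ccontr)
    assume "\<not> f t > 0"
    moreover have "continuous_on {a..t} f"
      using f by (rule continuous_on_subset) (use t c in auto)
    ultimately obtain z where "a \<le> z" "z \<le> t" "f z = 0"
      using IVT2'[of f t 0 a] assms t by auto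
    then show False using least[of z] t c by auto
  qed
  moreover have "a < c" using c assms(3) by (cases "a = c") auto
  ultimately show thesis using that c by auto
qed

section \<open>The Riemann problem\<close>

theorem theorem4p1:
  fixes \<rho>m \<rho>p um up :: real
    and s w u\<delta> :: "real \<Rightarrow> real"
    and \<rho> u :: "real \<Rightarrow> real \<Rightarrow> real"
  assumes "\<rho>m > 0" and "\<rho>p > 0" and "um > up"
    and "\<And>t. s t = 1/2 * (um * (1 - exp (- t)) + up * t + 1/2 * t\<^sup>2)"
    and "\<And>t. w t = 1/2 * (\<rho>m + \<rho>p) * (um * (1 - exp (- t)) - up * t - 1/2 * t\<^sup>2)"
    and "\<And>t. u\<delta> t = 1/2 * (um * exp (- t) + up + t)"
    and "\<And>x t. (\<rho> x t, u x t) =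
          (if x < s t then (\<rho>m, um * exp (- t))
           else if x = s t then (w t, u\<delta> t)
           else (\<rho>p, up + t))"
  shows "\<exists>T>0.
    delta_shock_solution (\<lambda>x t v. 1) (\<lambda>x t v. - v) (\<rho>m, um) (\<rho>p, up) (ereal T) s w u\<delta> \<rho> u \<and>
    \<not> delta_entropy s u T"
proof -
  have \<rho>l: "\<rho> x t = \<rho>m" and ul: "u x t = um * exp (- t)" if "x < s t" for x t
    using assms(7)[of x t] that by simp_all
  have \<rho>r: "\<rho> x t = \<rho>p" and ur: "u x t = up + t" if "s t < x" for x t
    using assms(7)[of x t] that by simp_all
  have \<rho>s: "\<rho> (s t) t = w t" and us: "u (s t) t = u\<delta> t" for t
    using assms(7)[of "s t" t] by simp_all
  have zero: "s 0 = 0" "w 0 = 0" by (simp_all add: assms(4,5))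

  have "s = (\<lambda>t. 1/2 * (um * (1 - exp (- t)) + up * t + 1/2 * t\<^sup>2))"
    using assms(4) by auto
  then have s': "(s has_real_derivative (um * exp (- t) + (up + t)) / 2) (at t within A)" for t A
    by (auto intro!: derivative_eq_intros simp: field_simps)
  have "w = (\<lambda>t. 1/2 * (\<rho>m + \<rho>p) * (um * (1 - exp (- t)) - up * t - 1/2 * t\<^sup>2))"
    using assms(5) by auto
  then have w': "(w has_real_derivative (\<rho>m + \<rho>p) * (um * exp (- t) - (up + t)) / 2) (at t within A)"
    for t A
    by (auto intro!: derivative_eq_intros simp: field_simps)
  have s_cont: "continuous_on UNIV s"
    using s' by (rule DERIV_continuous_on)

  \<comment> \<open>At \<open>b = \<bar>um\<bar> + \<bar>up\<bar>\<close> the gap is at most \<open>\<bar>um\<bar> - up - b \<le> 0\<close>.\<close>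
  define b where "b = \<bar>um\<bar> + \<bar>up\<bar>"
  have "um * exp (- b) \<le> \<bar>um\<bar> * 1"
    by (rule mult_mono) (auto simp: b_def)
  then have "um * exp (- b) - (up + b) \<le> 0" by (simp add: b_def)
  moreover have "continuous_on {0..b} (\<lambda>t. um * exp (- t) - (up + t))"
    by (intro continuous_intros)
  ultimately obtain T where T: "0 < T" "um * exp (- T) - (up + T) = 0"
    and before: "\<And>t. 0 \<le> t \<Longrightarrow> t < T \<Longrightarrow> um * exp (- t) - (up + t) > 0"
    using continuous_first_zero[of 0 b "\<lambda>t. um * exp (- t) - (up + t)"] assms(3)
    by (auto simp: b_def)

  have entropy: "delta_entropy s u t \<longleftrightarrow> up + t < um * exp (- t)" if "0 \<le> t" for t
    by (rule delta_entropy_mean_velocity_iff) (use ul ur s' that in auto)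
  have left: "smooth_solution_on (left_region (ereal T) s) (\<lambda>x t v. - v) \<rho> u"
    by (rule uniform_state_smooth_solution[OF openin_left_region[OF s_cont] _ assms(1),
          where U = "\<lambda>t. um * exp (- t)"])
      (auto simp: left_region_def \<rho>l ul intro!: smooth_on_exp_decay derivative_eq_intros)
  have right: "smooth_solution_on (right_region (ereal T) s) (\<lambda>x t v. 1) \<rho> u"
    by (rule uniform_state_smooth_solution[OF openin_right_region[OF s_cont] _ assms(2),
          where U = "\<lambda>t. up + t"])
      (auto simp: right_region_def \<rho>r ur intro!: smooth_on_shifted_time derivative_eq_intros)
  have front: "has_traces \<rho> s t" "has_traces u s t" "rankine_hugoniot s w u\<delta> \<rho> u t" for t
  proof -
    show "has_traces \<rho> s t" using \<rho>l \<rho>r by (rule has_traces_uniform)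
    show "has_traces u s t" using ul ur by (rule has_traces_uniform)
    show "rankine_hugoniot s w u\<delta> \<rho> u t"
      by (rule rankine_hugoniot_mean_velocity)
        (fact \<rho>l \<rho>r ul ur s' w' | simp add: assms(6))+
  qed
  have "delta_shock_solution (\<lambda>x t v. 1) (\<lambda>x t v. - v) (\<rho>m, um) (\<rho>p, up) (ereal T) s w u\<delta> \<rho> u"
    unfolding delta_shock_solution_def
    using T(1) zero left right front \<rho>s us before
    by (auto simp: \<rho>l ul \<rho>r ur entropy time_domain_def)
  moreover have "\<not> delta_entropy s u T"
    using T entropy by simp
  ultimately show ?thesis using T(1) by blast
qed

end
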